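(* Let $a$ be a nonzero rational number and let $p,q$ be rational numbers with $p^2+q^2\neq0$. The polynomial $x^5+ax^2+ax+1$ is divisible by $x^2+px+q$ if and only if $q\neq0$, $p=q+1$ and \[a=\frac{q^4+q^3+q^2+q+1}{q}.\] In this case \[x^5+ax^2+ax+1=\big(x^2+(q+1)x+q\big)\Big(x^3-(q+1)x^2+(q^2+q+1)x+\frac1q\Big).\]
   Context: All polynomials are in $\mathbb{Q}[x]$; divisibility is in $\mathbb{Q}[x]$. *)

theory Defs
  imports Complex_Main "HOL-Computational_Algebra.Polynomial"
begin

end

theory Submission
  imports Defs "HOL-Computational_Algebra.Nth_Powers"
begin

text \<open>
  Euclidean division by \<open>x\<^sup>2 + p x + q\<close> shows that divisibility forces \<open>q \<noteq> 0\<close> and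
  \<open>(p - q - 1) (q p\<^sup>2 + q p - q\<^sup>2 + q - 1) = 0\<close>. Everything hinges on the second factor having
  no rational zero with \<open>q \<noteq> 0\<close>, that is, on \<open>p\<^sup>2 + p + 1 = q + 1/q\<close> being unsolvable.
  Comparing reduced fractions, numerator and denominator of \<open>q\<close> are squares \<open>c\<^sup>2\<close>, \<open>d\<^sup>2\<close>,
  and \<open>c\<^sup>4 - c\<^sup>2d\<^sup>2 + d\<^sup>4 = u (u + c d)\<close>. Parity makes one of \<open>c\<close>, \<open>d\<close> even,
  which leads to \<open>z\<^sup>2 = d\<^sup>4 - 3 d\<^sup>2e\<^sup>2 + 16 e\<^sup>4\<close> with \<open>d\<close> odd and coprime to \<open>e \<noteq> 0\<close>;
  this is excluded by infinite descent on \<open>\<bar>e\<bar>\<close> (a 2-descent on an elliptic curve of rank 0).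
\<close>

section \<open>Integer arithmetic: coprime factors, squares and residues\<close>

lemma coprime_mult_eq_square_int:
  fixes a b c :: int
  assumes "coprime a b" "a * b = c\<^sup>2" "a > 0" "b > 0"
  obtains x y where "a = x\<^sup>2" "b = y\<^sup>2"
proof -
  have eq: "nat a * nat b = (nat \<bar>c\<bar>)\<^sup>2"
    using assms(2-4) by (metis less_imp_le nat_mult_distrib nat_power_eq abs_ge_zero power2_abs)
  have cop: "coprime (nat a) (nat b)"
    using assms by (metis coprime_int_iff less_imp_le nat_0_le)
  have "is_nth_power 2 (nat a * nat b)"
    unfolding eq by (simp add: is_nth_power_def)
  then have "is_nth_power 2 (nat a)" "is_nth_power 2 (nat b)"
    using is_nth_power_mult_coprime_natD[OF cop, of 2] assms(3,4) by auto
  then obtain x y where "nat a = x\<^sup>2" "nat b = y\<^sup>2"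
    by (auto simp: is_nth_power_def)
  then have "a = (int x)\<^sup>2" "b = (int y)\<^sup>2"
    using assms(3,4) by (metis less_imp_le nat_0_le of_nat_power)+
  then show thesis by (rule that)
qed

lemma odd_square_mod_8:
  fixes x :: int
  assumes "odd x"
  obtains k where "x\<^sup>2 = 8 * k + 1"
proof -
  obtain m where m: "x = 2 * m + 1" using assms by (elim oddE)
  obtain k where k: "m * (m + 1) = 2 * k" by (metis dvd_def even_mult_iff odd_even_add odd_one)
  have "x\<^sup>2 = 4 * (m * (m + 1)) + 1" unfolding m by (simp add: power2_eq_square algebra_simps)
  also have "\<dots> = 8 * k + 1" unfolding k by simp
  finally show thesis by (rule that)
qed

text \<open>Take \<alpha> to be \<open>gcd r f\<close>, with coprime cofactors \<beta>, \<gamma>.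
  Cancelling \<alpha> leaves \<open>\<beta> * s = \<gamma> * d\<close>, so \<gamma> divides
  \<open>s\<close>.\<close>

lemma mult_eq_mult_decomp_int:
  fixes r s f d :: int
  assumes "r * s = f * d" "f \<noteq> 0"
  obtains \<alpha> \<beta> \<gamma> \<delta> where "r = \<alpha> * \<beta>" "s = \<gamma> * \<delta>" "f = \<alpha> * \<gamma>" "d = \<beta> * \<delta>" "coprime \<beta> \<gamma>"
proof -
  have "gcd r f \<noteq> 0" using assms(2) by simp
  then obtain \<beta> \<gamma> where bg: "r = \<beta> * gcd r f" "f = \<gamma> * gcd r f" "coprime \<beta> \<gamma>"
    using gcd_coprime_exists by blast
  define \<alpha> where "\<alpha> = gcd r f"
  have r: "r = \<alpha> * \<beta>" and f: "f = \<alpha> * \<gamma>" and "\<alpha> \<noteq> 0"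
    using bg assms(2) unfolding \<alpha>_def by (auto simp: mult.commute)
  have eq: "\<beta> * s = \<gamma> * d"
    using assms(1) \<open>\<alpha> \<noteq> 0\<close> unfolding r f by simp
  then have "\<gamma> dvd s"
    using bg(3) by (metis coprime_commute coprime_dvd_mult_right_iff dvd_triv_left)
  then obtain \<delta> where s: "s = \<gamma> * \<delta>" by blast
  have "\<gamma> \<noteq> 0" using assms(2) f by auto
  then have "d = \<beta> * \<delta>" using eq unfolding s by (simp add: mult.left_commute)
  with r s f bg(3) show thesis using that by blast
qed

text \<open>Since 11 is 3 modulo 4, -1 is not a square modulo 11. All pairs of residues are
  checked.\<close>

lemma eleven_dvd_sum_squaresD:
  fixes x y :: int
  assumes "11 dvd x\<^sup>2 + y\<^sup>2"
  shows "11 dvd x"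
proof -
  have "(x mod 11 = 0 \<or> x mod 11 = 1 \<or> x mod 11 = 2 \<or> x mod 11 = 3 \<or> x mod 11 = 4 \<or> x mod 11 = 5
      \<or> x mod 11 = 6 \<or> x mod 11 = 7 \<or> x mod 11 = 8 \<or> x mod 11 = 9 \<or> x mod 11 = 10)"
    and "(y mod 11 = 0 \<or> y mod 11 = 1 \<or> y mod 11 = 2 \<or> y mod 11 = 3 \<or> y mod 11 = 4 \<or> y mod 11 = 5
      \<or> y mod 11 = 6 \<or> y mod 11 = 7 \<or> y mod 11 = 8 \<or> y mod 11 = 9 \<or> y mod 11 = 10)"
    by presburger+
  moreover have "((x mod 11)\<^sup>2 + (y mod 11)\<^sup>2) mod 11 = 0"
    using assms by (simp add: mod_add_cong[OF power_mod power_mod] dvd_eq_mod_eq_0)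
  ultimately have "x mod 11 = 0"
    by (elim disjE) simp_all
  then show ?thesis by presburger
qed

section \<open>Infinite descent on the quartic\<close>

text \<open>First half of the descent step. Splitting \<open>r * s = f * d\<close> into four factors
  turns \<open>eq\<close> into a proportion between \<open>\<delta>^2 - 11 \<alpha>^2\<close> and
  \<open>\<gamma>^2\<close>, and between \<open>\<delta>^2 - 16 \<alpha>^2\<close> and
  \<open>\<beta>^2\<close>. The common ratio \<open>k\<close> divides 5, and parity then forces it
  to be 1.\<close>

lemma square_differences_from_product:
  fixes d f r s :: int
  assumes eq: "d\<^sup>2 + 16 * f\<^sup>2 = 11 * r\<^sup>2 + s\<^sup>2" and prod: "r * s = f * d"
    and "coprime r s" "odd d" "f \<noteq> 0"
  obtains \<alpha> \<beta> \<gamma> \<delta> where "\<delta>\<^sup>2 - 16 * \<alpha>\<^sup>2 = \<beta>\<^sup>2" "\<delta>\<^sup>2 - 11 * \<alpha>\<^sup>2 = \<gamma>\<^sup>2"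
    "coprime \<alpha> \<delta>" "odd \<delta>" "odd \<beta>" "f = \<alpha> * \<gamma>"
proof -
  obtain \<alpha> \<beta> \<gamma> \<delta> where r: "r = \<alpha> * \<beta>" and s: "s = \<gamma> * \<delta>" and f: "f = \<alpha> * \<gamma>"
    and d: "d = \<beta> * \<delta>" and cop: "coprime \<beta> \<gamma>"
    using mult_eq_mult_decomp_int[OF prod \<open>f \<noteq> 0\<close>] by blast
  have odd: "odd \<beta>" "odd \<delta>" using \<open>odd d\<close> unfolding d by auto
  have cop': "coprime \<alpha> \<delta>" using \<open>coprime r s\<close> unfolding r s by simp
  have eq': "\<beta>\<^sup>2 * (\<delta>\<^sup>2 - 11 * \<alpha>\<^sup>2) = \<gamma>\<^sup>2 * (\<delta>\<^sup>2 - 16 * \<alpha>\<^sup>2)"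
    using eq unfolding r s f d by (simp add: power_mult_distrib algebra_simps)
  have "coprime (\<beta>\<^sup>2) (\<gamma>\<^sup>2)" using cop by simp
  then have "\<beta>\<^sup>2 dvd \<delta>\<^sup>2 - 16 * \<alpha>\<^sup>2"
    using eq' by (metis coprime_dvd_mult_right_iff dvd_triv_left)
  then obtain k where k1: "\<delta>\<^sup>2 - 16 * \<alpha>\<^sup>2 = \<beta>\<^sup>2 * k" by blast
  have "\<beta> \<noteq> 0" using odd by auto
  then have k2: "\<delta>\<^sup>2 - 11 * \<alpha>\<^sup>2 = \<gamma>\<^sup>2 * k"
    using eq' unfolding k1 by (simp add: mult.left_commute)
  \<comment> \<open>Eliminate first \<open>\<delta>^2\<close>, then \<open>\<alpha>^2\<close>, from
    \<open>k1\<close> and \<open>k2\<close>. As \<alpha> and \<delta> are coprime, only divisors of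
    5 remain for \<open>k\<close>.\<close>
  have "5 * \<alpha>\<^sup>2 = k * (\<gamma>\<^sup>2 - \<beta>\<^sup>2)" "5 * \<delta>\<^sup>2 = k * (16 * \<gamma>\<^sup>2 - 11 * \<beta>\<^sup>2)"
    using k1 k2 by (simp_all add: algebra_simps)
  then have "k dvd 5 * \<alpha>\<^sup>2" "k dvd 5 * \<delta>\<^sup>2" by simp_all
  then have "k dvd gcd (5 * \<alpha>\<^sup>2) (5 * \<delta>\<^sup>2)" by simp
  also have "gcd (5 * \<alpha>\<^sup>2) (5 * \<delta>\<^sup>2) = 5"
    using cop' by (simp add: gcd_mult_left)
  finally have k5: "k dvd 5" .
  then have "\<bar>k\<bar> \<le> 5" using zdvd_imp_le[of "\<bar>k\<bar>" 5] by simp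
  then have "k \<in> {-5,-4,-3,-2,-1,0,1,2,3,4,5}" by (simp add: abs_le_iff) presburger
  with k5 have k: "k = 1 \<or> k = -1 \<or> k = 5 \<or> k = -5" by auto
  obtain i where i: "\<delta>\<^sup>2 = 8 * i + 1" using odd by (auto elim: odd_square_mod_8)
  obtain j where j: "\<beta>\<^sup>2 = 8 * j + 1" using odd by (auto elim: odd_square_mod_8)
  \<comment> \<open>modulo 8, \<open>k1\<close> reads \<open>k = 1\<close>\<close>
  have "k = 1" using k k1 unfolding i j by (elim disjE; simp; presburger)
  with k1 k2 have "\<delta>\<^sup>2 - 16 * \<alpha>\<^sup>2 = \<beta>\<^sup>2" "\<delta>\<^sup>2 - 11 * \<alpha>\<^sup>2 = \<gamma>\<^sup>2" by simp_all
  with cop' odd f show thesis using that by blast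
qed

text \<open>Second half of the descent step. The difference of squares in \<open>b\<close> has
  coprime factors, hence square ones. Half the sum and half the difference of their roots
  parametrise \<alpha> and \<delta>, and \<open>c\<close> becomes the quartic again.\<close>

lemma quartic_from_square_differences:
  fixes \<alpha> \<beta> \<gamma> \<delta> :: int
  assumes b: "\<delta>\<^sup>2 - 16 * \<alpha>\<^sup>2 = \<beta>\<^sup>2" and c: "\<delta>\<^sup>2 - 11 * \<alpha>\<^sup>2 = \<gamma>\<^sup>2"
    and "coprime \<alpha> \<delta>" "odd \<delta>" "odd \<beta>"
  obtains g h where "\<gamma>\<^sup>2 = g^4 - 3 * g\<^sup>2 * h\<^sup>2 + 16 * h^4" "odd g" "coprime g h" "g * h = \<alpha>"
proof -
  note result = that
  \<comment> \<open>Only \<open>\<delta>^2\<close> matters, and a positive root makes both factors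
    of \<open>\<beta>^2\<close> positive.\<close>
  define D where "D = \<bar>\<delta>\<bar>"
  have D: "D\<^sup>2 = \<delta>\<^sup>2" "D > 0" "odd D" "coprime \<alpha> D"
    using assms unfolding D_def by auto
  have prod: "(D - 4 * \<alpha>) * (D + 4 * \<alpha>) = \<beta>\<^sup>2"
    using b D by (simp add: power2_eq_square algebra_simps)
  have "\<beta> \<noteq> 0" using \<open>odd \<beta>\<close> by auto
  then have "(D - 4 * \<alpha>) * (D + 4 * \<alpha>) > 0" unfolding prod by simp
  then have pos: "D - 4 * \<alpha> > 0" "D + 4 * \<alpha> > 0"
    using \<open>D > 0\<close> by (auto simp: zero_less_mult_iff)
  have "coprime (D - 4 * \<alpha>) (D + 4 * \<alpha>)"
  proof (rule coprimeI)
    fix t assume t: "t dvd D - 4 * \<alpha>" "t dvd D + 4 * \<alpha>"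
    have "t dvd (D + 4 * \<alpha>) + (D - 4 * \<alpha>)" "t dvd (D + 4 * \<alpha>) - (D - 4 * \<alpha>)"
      using t by (blast intro: dvd_add dvd_diff)+
    then have t': "t dvd 2 * D" "t dvd 8 * \<alpha>" by simp_all
    have "odd (D - 4 * \<alpha>)" using D(3) by simp
    then have "odd t" using t(1) dvd_trans by blast
    then have "coprime t 2" "coprime t (2^3)" by (simp_all del: power_numeral)
    then have "t dvd D" "t dvd \<alpha>"
      using t' by (simp_all add: coprime_dvd_mult_right_iff)
    then show "is_unit t" using D(4) by (meson coprime_common_divisor)
  qed
  then obtain x y where x: "D - 4 * \<alpha> = x\<^sup>2" and y: "D + 4 * \<alpha> = y\<^sup>2"
    using coprime_mult_eq_square_int[OF _ prod] pos by blast
  have "coprime (x\<^sup>2) (y\<^sup>2)" using \<open>coprime (D - 4 * \<alpha>) (D + 4 * \<alpha>)\<close> unfolding x y .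
  then have copxy: "coprime x y" by simp
  have "odd (x\<^sup>2)" "odd (y\<^sup>2)" unfolding x[symmetric] y[symmetric] using D by auto
  then have "odd x" "odd y" by simp_all
  then have "even (x + y)" by simp
  \<comment> \<open>\<open>g\<close> and \<open>h\<close> are \<open>(y + x) / 2\<close> and
    \<open>(y - x) / 2\<close>, integers because \<open>x\<close> and \<open>y\<close> are
    odd.\<close>
  then obtain g where g: "x + y = 2 * g" by blast
  define h where "h = y - g"
  have xy: "x = g - h" "y = g + h" using g unfolding h_def by auto
  have a: "2 * \<alpha> = g * h" and DD: "D = g\<^sup>2 + h\<^sup>2"
    using x y unfolding xy by (simp_all add: power2_eq_square algebra_simps)
  have cgh: "coprime g h"
  proof (rule coprimeI)
    fix t assume "t dvd g" "t dvd h"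
    then have "t dvd x" "t dvd y" unfolding xy by simp_all
    then show "is_unit t" using copxy by (meson coprime_common_divisor)
  qed
  have gh: "odd (g + h)" using \<open>odd y\<close> xy by simp
  \<comment> \<open>Exactly one of \<open>g\<close>, \<open>h\<close> is even. The relations are
    symmetric in them, so \<open>v\<close> stands for the even one, whose half enters the
    quartic.\<close>
  have main: thesis
    if "odd u" "coprime u v" "D = u\<^sup>2 + v\<^sup>2" "2 * \<alpha> = u * v" "even v" for u v
  proof -
    obtain w where w: "v = 2 * w" using \<open>even v\<close> by blast
    have aw: "u * w = \<alpha>" using that(4) w by simp
    have "\<gamma>\<^sup>2 = (u\<^sup>2 + v\<^sup>2)\<^sup>2 - 11 * (u * w)\<^sup>2" using c D that(3) aw by simp
    also have "\<dots> = u^4 - 3 * u\<^sup>2 * w\<^sup>2 + 16 * w^4"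
      unfolding w by algebra
    finally show thesis using that(1,2) aw w by (intro result[of u w]) auto
  qed
  show thesis
  proof (cases "even h")
    case True
    then show thesis using main[of g h] gh cgh DD a by simp
  next
    case False
    then show thesis using main[of h g] gh cgh DD a by (simp add: ac_simps coprime_commute)
  qed
qed

text \<open>A solution with nonzero \<open>e\<close> has \<open>e = 2 * f\<close>, and the two
  halves of the descent step yield a solution whose second entry \<open>h\<close> divides
  \<open>f\<close>.\<close>

lemma quartic_eq_square_imp_zero:
  fixes d e z :: int
  assumes "z\<^sup>2 = d^4 - 3 * d\<^sup>2 * e\<^sup>2 + 16 * e^4" "odd d" "coprime d e"
  shows "e = 0"
  using assms
proof (induction "nat \<bar>e\<bar>" arbitrary: d e z rule: less_induct)
  case less
  note z = less.prems(1) and d = less.prems(2) and de = less.prems(3)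
  show "e = 0"
  proof (rule ccontr)
    assume "e \<noteq> 0"
    obtain i where i: "d\<^sup>2 = 8 * i + 1" using d by (elim odd_square_mod_8)
    have "even e"
    proof (rule ccontr)
      assume "odd e"
      then obtain j where j: "e\<^sup>2 = 8 * j + 1" by (elim odd_square_mod_8)
      \<comment> \<open>If \<open>d\<close> and \<open>e\<close> are both odd, the right side is 14
        modulo 8, twice an odd number, so it is no square.\<close>
      have "z\<^sup>2 = (d\<^sup>2)\<^sup>2 - 3 * d\<^sup>2 * e\<^sup>2 + 16 * (e\<^sup>2)\<^sup>2" using z by simp
      also have "\<dots> = 2 * (4 * (8*i*i + 2*i - 24*i*j - 3*i - 3*j + 16*(8*j*j + 2*j)) + 7)"
        unfolding i j by (simp add: power2_eq_square algebra_simps)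
      finally have zz: "z\<^sup>2 = 2 * (4 * (8*i*i + 2*i - 24*i*j - 3*i - 3*j + 16*(8*j*j + 2*j)) + 7)" .
      then have "even (z\<^sup>2)" by simp
      then obtain w where "z = 2 * w" by auto
      then have "4 * w\<^sup>2 = 2 * (4 * (8*i*i + 2*i - 24*i*j - 3*i - 3*j + 16*(8*j*j + 2*j)) + 7)"
        using zz by (simp add: power_mult_distrib)
      then show False by presburger
    qed
    then obtain f where f: "e = 2 * f" by blast
    have "f \<noteq> 0" using f \<open>e \<noteq> 0\<close> by simp
    have df: "coprime d f" using de unfolding f by simp
    \<comment> \<open>Completing the square makes \<open>A^2 - z^2\<close> equal to
      \<open>44 (f d)^2\<close>. Its factors \<open>A + z\<close> and \<open>A - z\<close> are twice
      \<open>U\<close> and \<open>V\<close>, so \<open>U * V\<close> is 11 times a square.\<close>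
    define A where "A = d\<^sup>2 + 16 * f\<^sup>2"
    have zA: "z\<^sup>2 = A\<^sup>2 - 44 * (f * d)\<^sup>2" unfolding z f A_def by algebra
    have "odd A" using d unfolding A_def by simp
    have "odd (z\<^sup>2)" unfolding zA using \<open>odd A\<close> by simp
    then have "even (A + z)" using \<open>odd A\<close> by simp
    then obtain U where U: "A + z = 2 * U" by blast
    define V where "V = A - U"
    have A: "A = U + V" and zUV: "z = U - V" using U unfolding V_def by simp_all
    have UV: "U * V = 11 * (f * d)\<^sup>2"
      using zA unfolding A zUV by (simp add: power2_eq_square algebra_simps)
    have "A > 0" using \<open>f \<noteq> 0\<close> unfolding A_def by (simp add: add_nonneg_pos)
    moreover have "f * d \<noteq> 0" using d \<open>f \<noteq> 0\<close> by auto
    then have "U * V > 0" unfolding UV by simp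
    ultimately have pos: "U > 0" "V > 0"
      unfolding A by (auto simp: zero_less_mult_iff)
    \<comment> \<open>Needed for coprimality: a common divisor of \<open>U\<close> and
      \<open>V\<close> divides both \<open>A = U + V\<close> and \<open>11 (f d)^2\<close>.\<close>
    have "\<not> 11 dvd A"
    proof
      assume "11 dvd A"
      then have *: "11 dvd d\<^sup>2 + (4 * f)\<^sup>2" unfolding A_def by simp
      then have "11 dvd d" by (rule eleven_dvd_sum_squaresD)
      have "11 dvd 4 * f" using * by (intro eleven_dvd_sum_squaresD[of "4 * f" d]) (simp add: add.commute)
      then have "11 dvd f" by presburger
      with \<open>11 dvd d\<close> df have "is_unit (11::int)" by (meson coprime_common_divisor)
      then show False by simp
    qed
    have "coprime A 11"
    proof -
      have "prime (11::int)" by simp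
      then show ?thesis using \<open>\<not> 11 dvd A\<close> by (metis coprime_commute prime_imp_coprime)
    qed
    have "coprime (d\<^sup>2 + 16 * f\<^sup>2) d"
    proof -
      have "coprime (16 * f\<^sup>2) d"
      proof -
        have "coprime (2^4) d" using d by (simp del: power_numeral)
        then show ?thesis using df by (simp add: coprime_commute)
      qed
      then show ?thesis
        by (metis coprime_iff_gcd_eq_1 gcd.commute gcd_add_mult power2_eq_square add.commute)
    qed
    moreover have "coprime (d\<^sup>2 + 16 * f\<^sup>2) f"
    proof -
      have "coprime (d\<^sup>2) f" using df by simp
      moreover have "gcd f (16 * f * f + d\<^sup>2) = gcd f (d\<^sup>2)" by (rule gcd_add_mult)
      ultimately show ?thesis
        by (simp add: coprime_iff_gcd_eq_1 gcd.commute power2_eq_square ac_simps)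
    qed
    ultimately have "coprime A (11 * (f * d)\<^sup>2)"
      using \<open>coprime A 11\<close> unfolding A_def by simp
    then have cUV: "coprime U V"
      unfolding UV[symmetric] A
      by (intro coprimeI) (metis coprime_common_divisor dvd_add dvd_mult2)
    \<comment> \<open>Stated for arbitrary \<open>U\<close>, \<open>V\<close>, because 11 may divide
      either factor. The one it divides is 11 times a square, the other a square.\<close>
    have key: False
      if UV: "U * V = 11 * (f * d)\<^sup>2" and A: "A = U + V" and pos: "U > 0" "V > 0"
        and cop: "coprime U V" and dvd: "11 dvd U" for U V
    proof -
      obtain W where W: "U = 11 * W" using dvd by blast
      have "W * V = (f * d)\<^sup>2" "coprime W V" "W > 0" "V > 0"
        using UV pos cop unfolding W by simp_all
      then obtain r s where rs: "W = r\<^sup>2" "V = s\<^sup>2"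
        using coprime_mult_eq_square_int by metis
      have "(r * s)\<^sup>2 = (f * d)\<^sup>2" using \<open>W * V = _\<close> rs by (simp add: power_mult_distrib)
      \<comment> \<open>The sign of \<open>r\<close> is free. It is chosen to make the product
        exactly \<open>f * d\<close>.\<close>
      then have "r * s = f * d \<or> (- r) * s = f * d" by (auto simp: power2_eq_iff)
      moreover have "coprime r s" "coprime (- r) s" using \<open>coprime W V\<close> rs by simp_all
      moreover have "(- r)\<^sup>2 = r\<^sup>2" by simp
      ultimately obtain r' where r': "r' * s = f * d" "r'\<^sup>2 = r\<^sup>2" "coprime r' s" by blast
      have eq: "d\<^sup>2 + 16 * f\<^sup>2 = 11 * r'\<^sup>2 + s\<^sup>2" using A W rs r' unfolding A_def by simp
      obtain \<alpha> \<beta> \<gamma> \<delta> where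
        1: "\<delta>\<^sup>2 - 16 * \<alpha>\<^sup>2 = \<beta>\<^sup>2" "\<delta>\<^sup>2 - 11 * \<alpha>\<^sup>2 = \<gamma>\<^sup>2" "coprime \<alpha> \<delta>" "odd \<delta>" "odd \<beta>"
        and fag: "f = \<alpha> * \<gamma>"
        using square_differences_from_product[OF eq r'(1,3) d \<open>f \<noteq> 0\<close>] by metis
      obtain g h where gh: "\<gamma>\<^sup>2 = g^4 - 3 * g\<^sup>2 * h\<^sup>2 + 16 * h^4" "odd g" "coprime g h" "g * h = \<alpha>"
        using quartic_from_square_differences[OF 1] by blast
      have "h dvd f" unfolding fag gh(4)[symmetric] by simp
      then have "\<bar>h\<bar> \<le> \<bar>f\<bar>" using \<open>f \<noteq> 0\<close> by (simp add: dvd_imp_le_int)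
      then have "nat \<bar>h\<bar> < nat \<bar>e\<bar>" using f \<open>f \<noteq> 0\<close> by simp
      \<comment> \<open>The induction hypothesis applies to \<open>h\<close>, but
        \<open>h = 0\<close> gives \<alpha> = 0 and hence \<open>f = 0\<close>.\<close>
      then have "h = 0" using less.hyps gh by blast
      then show False using \<open>f \<noteq> 0\<close> fag gh(4) by simp
    qed
    have "11 dvd U * V" unfolding UV by simp
    moreover have "prime (11::int)" by simp
    ultimately have "11 dvd U \<or> 11 dvd V" by (simp add: prime_dvd_mult_iff)
    then show False
    proof
      assume "11 dvd U"
      then show False using key[OF UV A pos cUV] by blast
    next
      assume "11 dvd V"
      then show False using key[of V U] UV A pos cUV by (simp add: ac_simps coprime_commute)
    qed
  qed
qed

section \<open>From the rational equation to the quartic\<close>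

text \<open>If \<open>c\<close> and \<open>d\<close> were both odd, the two sides would differ in
  parity. Writing the even one as \<open>2 * f\<close> and completing the square in \<open>u\<close>
  gives the quartic of the descent, so that one vanishes.\<close>

lemma quartic_eq_imp_zero:
  fixes c d u :: int
  assumes eq: "c^4 + d^4 = u\<^sup>2 + u * (c * d) + c\<^sup>2 * d\<^sup>2" and cop: "coprime c d"
  shows "c * d = 0"
proof -
  have aux: "e = 0" if "even e" and eq: "e^4 + g^4 = u\<^sup>2 + u * (e * g) + e\<^sup>2 * g\<^sup>2"
    and cop: "coprime e g" for e g :: int
  proof -
    obtain f where f: "e = 2 * f" using \<open>even e\<close> by blast
    have "(u + f * g)\<^sup>2 = g^4 - 3 * g\<^sup>2 * f\<^sup>2 + 16 * f^4"
      using eq unfolding f by algebra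
    moreover have "odd g" "coprime g f" using cop unfolding f by (auto simp: coprime_commute)
    ultimately have "f = 0" by (rule quartic_eq_square_imp_zero)
    then show ?thesis using f by simp
  qed
  have "even c \<or> even d"
  proof (rule ccontr)
    assume "\<not> (even c \<or> even d)"
    then have "even (c^4 + d^4)" "odd (u\<^sup>2 + u * (c * d) + c\<^sup>2 * d\<^sup>2)" by auto
    then show False using eq by simp
  qed
  then show ?thesis
    using aux[of c d] aux[of d c] eq cop by (auto simp: ac_simps coprime_commute)
qed

lemma quadratic_cofactor_ne_zero:
  fixes p q :: rat
  assumes "q \<noteq> 0"
  shows "q * p\<^sup>2 + q * p - q\<^sup>2 + q - 1 \<noteq> 0"
proof
  assume 0: "q * p\<^sup>2 + q * p - q\<^sup>2 + q - 1 = 0"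
  obtain m n where mn: "quotient_of q = (m, n)" by (cases "quotient_of q")
  obtain u v where uv: "quotient_of p = (u, v)" by (cases "quotient_of p")
  have q: "q = of_int m / of_int n" "n > 0" "coprime m n"
    using mn quotient_of_div quotient_of_denom_pos quotient_of_coprime by auto
  have p: "p = of_int u / of_int v" "v > 0" "coprime u v"
    using uv quotient_of_div quotient_of_denom_pos quotient_of_coprime by auto
  have "m \<noteq> 0" using assms q by auto
  define M N U V where "M = (of_int m :: rat)" and "N = (of_int n :: rat)"
    and "U = (of_int u :: rat)" and "V = (of_int v :: rat)"
  have nz: "N \<noteq> 0" "V \<noteq> 0" using q p unfolding N_def V_def by auto
  have "M = q * N" "U = p * V" using nz unfolding q p M_def N_def U_def V_def by simp_all
  \<comment> \<open>This is \<open>p^2 + p + 1 = q + 1/q\<close> with denominators cleared. On each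
    side the two factors are coprime to each other's counterpart in the sense of \<open>cop1\<close>
    and \<open>cop2\<close>, so \<open>m * n\<close> and \<open>v^2\<close> divide each
    other.\<close>
  with 0 have "M * N * (U\<^sup>2 + U * V + V\<^sup>2) = (M\<^sup>2 + N\<^sup>2) * V\<^sup>2" by algebra
  then have "of_int (m * n * (u\<^sup>2 + u * v + v\<^sup>2)) = (of_int ((m\<^sup>2 + n\<^sup>2) * v\<^sup>2) :: rat)"
    unfolding M_def N_def U_def V_def by simp
  then have eq: "m * n * (u\<^sup>2 + u * v + v\<^sup>2) = (m\<^sup>2 + n\<^sup>2) * v\<^sup>2"
    by (simp only: of_int_eq_iff)
  have cop1: "coprime (m * n) (m\<^sup>2 + n\<^sup>2)"
  proof -
    have "gcd m (m * m + n\<^sup>2) = gcd m (n\<^sup>2)" "gcd n (n * n + m\<^sup>2) = gcd n (m\<^sup>2)"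
      by (rule gcd_add_mult)+
    moreover have "coprime m (n\<^sup>2)" "coprime n (m\<^sup>2)" using q by (simp_all add: coprime_commute)
    ultimately have "coprime m (m\<^sup>2 + n\<^sup>2)" "coprime n (m\<^sup>2 + n\<^sup>2)"
      by (simp_all add: coprime_iff_gcd_eq_1 power2_eq_square add.commute)
    then show ?thesis by simp
  qed
  have cop2: "coprime (v\<^sup>2) (u\<^sup>2 + u * v + v\<^sup>2)"
  proof -
    have "gcd v ((u + v) * v + u\<^sup>2) = gcd v (u\<^sup>2)" by (rule gcd_add_mult)
    moreover have "coprime v (u\<^sup>2)" using p by (simp add: coprime_commute)
    ultimately have "coprime v (u\<^sup>2 + u * v + v\<^sup>2)"
      by (simp add: coprime_iff_gcd_eq_1 power2_eq_square algebra_simps)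
    then show ?thesis by simp
  qed
  have "m * n dvd v\<^sup>2"
    using eq cop1 by (metis coprime_dvd_mult_right_iff dvd_triv_left)
  moreover have "v\<^sup>2 dvd m * n"
    using eq cop2 by (metis coprime_dvd_mult_left_iff dvd_triv_right)
  ultimately have "\<bar>m * n\<bar> = v\<^sup>2"
    by (metis abs_power2 zdvd_antisym_abs)
  \<comment> \<open>Both quadratic forms are positive, which settles the sign in
    \<open>m * n = v^2\<close>.\<close>
  moreover have "m * n > 0"
  proof -
    have "4 * (u\<^sup>2 + u * v + v\<^sup>2) = (2 * u + v)\<^sup>2 + 3 * v\<^sup>2" by algebra
    moreover have "(2 * u + v)\<^sup>2 + 3 * v\<^sup>2 > 0" using p by (simp add: add_nonneg_pos)
    ultimately have pos: "u\<^sup>2 + u * v + v\<^sup>2 > 0" by simp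
    have "(m\<^sup>2 + n\<^sup>2) * v\<^sup>2 > 0" using p q by (simp add: add_nonneg_pos)
    then show ?thesis using eq pos by (metis zero_less_mult_pos2)
  qed
  ultimately have mnv: "m * n = v\<^sup>2" by simp
  then have eq2: "u\<^sup>2 + u * v + v\<^sup>2 = m\<^sup>2 + n\<^sup>2" using eq p by simp
  have "m > 0" using \<open>m * n > 0\<close> q by (simp add: zero_less_mult_iff)
  then obtain c d where cd: "m = c\<^sup>2" "n = d\<^sup>2"
    using coprime_mult_eq_square_int[OF q(3) mnv] q(2) by blast
  have "(c * d)\<^sup>2 = v\<^sup>2" using mnv cd by (simp add: power_mult_distrib)
  then have "v = c * d \<or> v = (- c) * d" by (auto simp: power2_eq_iff)
  \<comment> \<open>Changing the sign of \<open>c\<close> leaves \<open>m\<close> unchanged and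
    gives \<open>v\<close> itself as a product.\<close>
  then obtain c' where c': "v = c' * d" "m = c'\<^sup>2" using cd by (metis power2_minus)
  have "c'^4 + d^4 = u\<^sup>2 + u * (c' * d) + c'\<^sup>2 * d\<^sup>2"
    using eq2 unfolding c' cd(2) by (simp add: power_mult_distrib flip: power_mult)
  moreover have "coprime c' d" using q(3) unfolding c' cd(2) by simp
  ultimately have "c' * d = 0" by (rule quartic_eq_imp_zero)
  then show False using c'(1) p(2) by auto
qed

section \<open>Polynomial division by the quadratic\<close>

lemma monic_quadratic_dvd_linear_iff:
  fixes p q s t :: rat
  shows "[:q, p, 1:] dvd [:s, t:] \<longleftrightarrow> s = 0 \<and> t = 0"
proof
  assume dvd: "[:q, p, 1:] dvd [:s, t:]"
  have "[:s, t:] = 0"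
  proof (rule ccontr)
    assume "[:s, t:] \<noteq> 0"
    from dvd_imp_degree_le[OF dvd this] show False by (simp split: if_splits)
  qed
  then show "s = 0 \<and> t = 0" by simp
qed simp

theorem theorem3p2:
  fixes a p q :: rat
  assumes "a \<noteq> 0" and "p\<^sup>2 + q\<^sup>2 \<noteq> 0"
  shows "([:q, p, 1:] dvd [:1, a, a, 0, 0, 1:] \<longleftrightarrow>
            q \<noteq> 0 \<and> p = q + 1 \<and> a = (q^4 + q^3 + q^2 + q + 1) / q) \<and>
         ([:q, p, 1:] dvd [:1, a, a, 0, 0, 1:] \<longrightarrow>
            [:1, a, a, 0, 0, 1:] =
              [:q, q + 1, 1:] * [:1 / q, q^2 + q + 1, - (q + 1), 1:])"
proof -
  \<comment> \<open>The constant term of the quotient, found by comparing coefficients of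
    \<open>x^2\<close>.\<close>
  define c where "c = a - p^3 + 2 * p * q"
  have division: "[:1, a, a, 0, 0, 1:] = [:q, p, 1:] * [:c, p\<^sup>2 - q, - p, 1:]
      + [:1 - q * c, a - p * c - q * (p\<^sup>2 - q):]"
    unfolding c_def by (simp add: power2_eq_square power3_eq_cube algebra_simps)
  have dvd_iff: "[:q, p, 1:] dvd [:1, a, a, 0, 0, 1:] \<longleftrightarrow>
      1 - q * c = 0 \<and> a - p * c - q * (p\<^sup>2 - q) = 0"
    unfolding division
    by (subst dvd_add_right_iff) (simp_all only: dvd_triv_left monic_quadratic_dvd_linear_iff)
  have factorisation: "[:1, a, a, 0, 0, 1:] =
      [:q, q + 1, 1:] * [:1 / q, q^2 + q + 1, - (q + 1), 1:]"
    if "q \<noteq> 0" "a = (q^4 + q^3 + q^2 + q + 1) / q"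
    using that by (simp add: field_simps power2_eq_square power3_eq_cube power4_eq_xxxx)
  have forward: "q \<noteq> 0 \<and> p = q + 1 \<and> a = (q^4 + q^3 + q^2 + q + 1) / q"
    if "[:q, p, 1:] dvd [:1, a, a, 0, 0, 1:]"
  proof -
    have r0: "1 - q * c = 0" and r1: "a - p * c - q * (p\<^sup>2 - q) = 0"
      using that dvd_iff by auto
    have "q \<noteq> 0" using r0 by auto
    \<comment> \<open>The left side is \<open>q\<close> times the linear remainder coefficient once
      \<open>a\<close> is expressed through \<open>c\<close> and \<open>q * c = 1\<close> is
      used.\<close>
    have "(p - q - 1) * (q * p\<^sup>2 + q * p - q\<^sup>2 + q - 1) = 0"
      using r0 r1 unfolding c_def by algebra
    then have p: "p = q + 1" using quadratic_cofactor_ne_zero[OF \<open>q \<noteq> 0\<close>, of p] by simp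
    \<comment> \<open>With \<open>p = q + 1\<close>, the condition \<open>q * c = 1\<close> is
      linear in \<open>a\<close>.\<close>
    have "a * q = q^4 + q^3 + q^2 + q + 1"
      using r0 unfolding c_def p by algebra
    then show ?thesis using p \<open>q \<noteq> 0\<close> by (simp add: field_simps)
  qed
  have backward: "[:q, p, 1:] dvd [:1, a, a, 0, 0, 1:]"
    if "q \<noteq> 0" "p = q + 1" "a = (q^4 + q^3 + q^2 + q + 1) / q"
    using factorisation[OF that(1,3)] that(2) by (metis dvd_triv_left)
  show ?thesis using forward backward factorisation by blast
qed

end
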